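(* Let $n\ge 1$, let $\lambda=(\lambda_1\ge\dots\ge\lambda_k>0)$ be a partition with $k\le n+1$ parts. The map $\psi: \mathrm{SSYT}_n(\lambda)\to MS_n$, $b\mapsto M_b$, is a weak embedding of crystals; that is, $\psi$ is injective and $\psi(e_i(b)) = e_i(\psi(b))$ for all $b\in \mathrm{SSYT}_n(\lambda)$ and all $1\le i\le n$ (with the convention $\psi(0)=0$).
   Context: **Multisegments.** A segment is an interval $[i,j]$ of integers with $1\le i\le j$; its height is $j-i+1$ and its bottom entry is $i$. A multisegment is a finite multiset of segments. $MS_n$ is the set of all multisegments all of whose segments $[i,j]$ satisfy $j\le n$. For $M\in MS_n$ and $1\le i\le n$, $S_i(M)$ is the string of brackets formed as follows: order the segments of $M$ from left to right in increasing order of height, and among segments of the same height from largest to smallest bottom entry; place a ")" for each segment $[h,i-1]$ and a "(" for each segment $[h,i]$. **Cancellation.** In a string of brackets, a "(" and a ")" are canceled if the "(" is directly to the left of the ")", or if the only brackets between them are canceled. $uc_i(M)$ is the string obtained from $S_i(M)$ by deleting canceled brackets (so it has the form $)\cdots)(\cdots($). **Operator $e_i$ on $MS_n$.** If there is no "(" in $uc_i(M)$ then $e_i(M)=0$. Otherwise, let $[h,i]$ be the segment corresponding to the left-most "(" in $uc_i(M)$: if $h\ne i$, $e_i(M)=(M\setminus\{[h,i]\})\cup\{[h,i-1]\}$; if $h=i$, $e_i(M)=M\setminus\{[i,i]\}$ (one copy removed). **Tableaux.** $\mathrm{SSYT}_n(\lambda)$ is the set of fillings of the Young diagram of $\lambda$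 (rows of lengths $\lambda_1,\lambda_2,\dots$ from top to bottom, left-justified) by numbers in $\{0,1,\dots,n\}$, weakly increasing along rows and strictly increasing down columns. For $1\le i\le n$ and $b\in\mathrm{SSYT}_n(\lambda)$, place a ")" above each column of $b$ containing $i-1$ but no $i$, and a "(" above each column containing $i$ but no $i-1$; read the string left to right and cancel brackets by the rule that a "(" and a ")" are canceled if the "(" is directly to the left of the ")", or if the "(" is to the left of the ")" and the only brackets between them are canceled. $e_i(b)$ is obtained by changing the $i$ corresponding to the left-most uncanceled "(" to $i-1$; if there is no uncanceled "(", $e_i(b)=0$. **The map.** For $b\in\mathrm{SSYT}_n(\lambda)$, $M_b$ is the multisegment containing one segment $[i,j]$ for each entry $j\ge i$ in the $i$-th row of $b$ (for all rows $i$, counted with multiplicity). *)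

theory Defs
  imports "HOL-Library.Multiset"
begin

section \<open>Bracket strings\<close>

datatype bracket = Open | Close

text \<open>
  A bracket string is a list of brackets, each carrying a label that records the object
  (segment or column) it was placed for. The relation \<open>cancels s p q\<close> says that the opening
  bracket at position \<open>p\<close> is canceled with the closing bracket at position \<open>q\<close>. The brackets
  between them have to be canceled among themselves; otherwise the first bracket
  of \<open>())\<close> would be canceled twice.
\<close>

inductive cancels :: "(bracket \<times> 'a) list \<Rightarrow> nat \<Rightarrow> nat \<Rightarrow> bool" for s where
  "\<lbrakk>p < q; q < length s; fst (s ! p) = Open; fst (s ! q) = Close;
    \<And>r. p < r \<Longrightarrow> r < q \<Longrightarrow> \<exists>r'. p < r' \<and> r' < q \<and> (cancels s r r' \<or> cancels s r' r)\<rbrakk>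
   \<Longrightarrow> cancels s p q"

definition canceled :: "(bracket \<times> 'a) list \<Rightarrow> nat \<Rightarrow> bool" where
  "canceled s p \<longleftrightarrow> (\<exists>q. cancels s p q \<or> cancels s q p)"

definition uncanceled :: "(bracket \<times> 'a) list \<Rightarrow> (bracket \<times> 'a) list" where
  "uncanceled s = nths s {p. \<not> canceled s p}"

definition leftmost_open :: "(bracket \<times> 'a) list \<Rightarrow> 'a option" where
  "leftmost_open s = map_option snd (find (\<lambda>x. fst x = Open) s)"


section \<open>Multisegments\<close>

text \<open>The pair \<open>(i, j)\<close> stands for the segment \<open>[i, j]\<close>.\<close>

type_synonym segment = "nat \<times> nat"

definition is_segment :: "segment \<Rightarrow> bool" where
  "is_segment = (\<lambda>(i, j). 1 \<le> i \<and> i \<le> j)"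

definition MS :: "nat \<Rightarrow> segment multiset set" where
  "MS n = {M. \<forall>x \<in># M. is_segment x \<and> snd x \<le> n}"

definition height :: "segment \<Rightarrow> nat" where
  "height = (\<lambda>(i, j). j - i + 1)"

definition seg_le :: "segment \<Rightarrow> segment \<Rightarrow> bool" where
  "seg_le x y \<longleftrightarrow> height x < height y \<or> (height x = height y \<and> fst x \<ge> fst y)"

definition ordered_segments :: "segment multiset \<Rightarrow> segment list" where
  "ordered_segments M = (THE xs. mset xs = M \<and> sorted_wrt seg_le xs)"

lemma ex1_ordered_segments:
  assumes "M \<in> MS n"
  shows "\<exists>!xs. mset xs = M \<and> sorted_wrt seg_le xs"
proof -
  have anti: "x = y" if "seg_le x y" "seg_le y x" "x \<in># M" "y \<in># M" for x y
  proof -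
    have "is_segment x" "is_segment y" using that(3,4) assms by (auto simp: MS_def)
    then show ?thesis
      using that(1,2) by (cases x; cases y) (auto simp: seg_le_def height_def is_segment_def)
  qed
  have "\<exists>xs. mset xs = M \<and> sorted_wrt seg_le xs"
  proof (induction M)
    case empty
    show ?case by simp
  next
    case (add x M)
    then obtain xs where xs: "mset xs = M" "sorted_wrt seg_le xs" by blast
    let ?ys = "filter (\<lambda>y. seg_le y x) xs" and ?zs = "filter (\<lambda>y. \<not> seg_le y x) xs"
    have "mset (?ys @ x # ?zs) = add_mset x M"
      using xs(1) by (metis mset_append mset.simps(2) mset_filter multiset_partition union_mset_add_mset_right)
    moreover have "sorted_wrt seg_le (?ys @ x # ?zs)"
      using xs(2) by (auto simp: sorted_wrt_append sorted_wrt_filter seg_le_def)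
    ultimately show ?case by blast
  qed
  moreover have "xs = ys"
    if "mset xs = mset ys" "sorted_wrt seg_le xs" "sorted_wrt seg_le ys" "set xs \<subseteq> set_mset M" for xs ys
    using that
  proof (induction xs arbitrary: ys)
    case Nil
    then show ?case by simp
  next
    case (Cons x xs)
    then obtain y zs where ys: "ys = y # zs" by (cases ys) auto
    have sets: "set (x # xs) = set ys" using Cons.prems(1) by (rule mset_eq_setD)
    have "x = y"
    proof (rule ccontr)
      assume "x \<noteq> y"
      then have "y \<in> set xs" "x \<in> set zs" using sets ys by auto
      then show False using Cons.prems ys anti[of x y] \<open>x \<noteq> y\<close> by auto
    qed
    then show ?case using Cons ys by auto
  qed
  ultimately show ?thesis by (auto simp flip: set_mset_mset)
qed

text \<open>Since \<open>i - 1\<close> is natural-number subtraction, the definitions below are meant for \<open>i \<ge> 1\<close>.\<close>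

definition seg_brackets :: "nat \<Rightarrow> segment \<Rightarrow> (bracket \<times> segment) list" where
  "seg_brackets i x =
     (if snd x = i - 1 then [(Close, x)] else if snd x = i then [(Open, x)] else [])"

definition seg_string :: "nat \<Rightarrow> segment multiset \<Rightarrow> (bracket \<times> segment) list" where
  "seg_string i M = concat (map (seg_brackets i) (ordered_segments M))"

text \<open>In both crystals the value \<open>None\<close> represents the element \<open>0\<close>.\<close>

definition e_MS :: "nat \<Rightarrow> segment multiset \<Rightarrow> segment multiset option" where
  "e_MS i M =
     (case leftmost_open (uncanceled (seg_string i M)) of
        None \<Rightarrow> None
      | Some (h, _) \<Rightarrow>
          Some (if h \<noteq> i then (M - {#(h, i)#}) + {#(h, i - 1)#} else M - {#(i, i)#}))"


section \<open>Semistandard Young tableaux\<close>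

definition is_partition :: "nat list \<Rightarrow> bool" where
  "is_partition l \<longleftrightarrow> sorted_wrt (\<ge>) l \<and> (\<forall>x \<in> set l. 0 < x)"

text \<open>A filling is the list of its rows from top to bottom; rows and columns are indexed from 0.\<close>

definition SSYT :: "nat \<Rightarrow> nat list \<Rightarrow> nat list list set" where
  "SSYT n l = {b. map length b = l
     \<and> (\<forall>row \<in> set b. set row \<subseteq> {0..n} \<and> sorted row)
     \<and> (\<forall>r c. Suc r < length b \<longrightarrow> c < length (b ! Suc r) \<longrightarrow> b ! r ! c < b ! Suc r ! c)}"

definition entry_at :: "nat list list \<Rightarrow> nat \<Rightarrow> nat \<Rightarrow> nat \<Rightarrow> bool" where
  "entry_at b r c x \<longleftrightarrow> r < length b \<and> c < length (b ! r) \<and> b ! r ! c = x"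

definition in_column :: "nat list list \<Rightarrow> nat \<Rightarrow> nat \<Rightarrow> bool" where
  "in_column b c x \<longleftrightarrow> (\<exists>r. entry_at b r c x)"

definition num_columns :: "nat list list \<Rightarrow> nat" where
  "num_columns b = (case b of [] \<Rightarrow> 0 | row # _ \<Rightarrow> length row)"

definition col_brackets :: "nat \<Rightarrow> nat list list \<Rightarrow> nat \<Rightarrow> (bracket \<times> nat) list" where
  "col_brackets i b c =
     (if in_column b c (i - 1) \<and> \<not> in_column b c i then [(Close, c)]
      else if in_column b c i \<and> \<not> in_column b c (i - 1) then [(Open, c)]
      else [])"

definition col_string :: "nat \<Rightarrow> nat list list \<Rightarrow> (bracket \<times> nat) list" where
  "col_string i b = concat (map (col_brackets i b) [0..<num_columns b])"

definition e_SSYT :: "nat \<Rightarrow> nat list list \<Rightarrow> nat list list option" where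
  "e_SSYT i b =
     (case leftmost_open (uncanceled (col_string i b)) of
        None \<Rightarrow> None
      | Some c \<Rightarrow> (let r = (THE r. entry_at b r c i) in Some (b[r := (b ! r)[c := i - 1]])))"

text \<open>The index \<open>r\<close> is the row in 0-based counting, so its entries give segments with bottom \<open>Suc r\<close>.\<close>

definition psi :: "nat list list \<Rightarrow> segment multiset" where
  "psi b = (\<Sum>r<length b. image_mset (\<lambda>j. (Suc r, j)) (filter_mset (\<lambda>j. Suc r \<le> j) (mset (b ! r))))"

end

theory Submission
  imports Defs
begin

text \<open>
  The segments ending in \<open>i - 1\<close> or \<open>i\<close> appear in the order of the heights, so the bracket string of
  \<open>M\<^sub>b\<close> lists the rows of \<open>b\<close> from bottom to top, with a closing bracket for each \<open>i - 1\<close> followed by an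
  opening one for each \<open>i\<close>. The columns of \<open>b\<close> that carry a bracket are met in the same order, and the
  only brackets missing there are those of the vertical pairs of an \<open>i\<close> in row \<open>r + 1\<close> under an
  \<open>i - 1\<close> in row \<open>r\<close>. In the string of \<open>M\<^sub>b\<close> these form adjacent opening and closing brackets, which
  cancel. (The entries \<open>i - 1\<close> in row \<open>i\<close> give no segment, but they only contribute closing brackets at
  the left end.) Hence the leftmost uncanceled opening brackets belong to the same row. It is found by
  a recursion from the right which records the number of uncanceled closing brackets.
\<close>

section \<open>Cancellation of brackets\<close>

lemma cancelsD:
  assumes "cancels s p q"
  shows "p < q" "q < length s" "fst (s ! p) = Open" "fst (s ! q) = Close"
    "\<And>r. p < r \<Longrightarrow> r < q \<Longrightarrow> \<exists>r'. p < r' \<and> r' < q \<and> (cancels s r r' \<or> cancels s r' r)"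
  using assms by (cases; blast)+

lemma cancels_between_Open:
  assumes "cancels s p q" "p < r" "r < q" "fst (s ! r) = Open"
  obtains r' where "r' < q" "cancels s r r'"
  using cancelsD(5)[OF assms(1-3)] cancelsD(4)[of s _ r] assms(4) by force

lemma cancels_between_Close:
  assumes "cancels s p q" "p < r" "r < q" "fst (s ! r) = Close"
  obtains r' where "p < r'" "cancels s r' r"
  using cancelsD(5)[OF assms(1-3)] cancelsD(3)[of s r] assms(4) by force

text \<open>Infinite descent: if \<open>p < p'\<close> both cancel \<open>q\<close>, then
  \<open>p'\<close> also cancels some \<open>r\<close> between \<open>p'\<close> and
  \<open>q\<close>, and \<open>r\<close> is in turn canceled with an opening bracket right of
  \<open>p'\<close>. So \<open>r < q\<close> has two partners as well.\<close>

lemma cancels_unique_open: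
  assumes "cancels s p q" "cancels s p' q"
  shows "p = p'"
proof -
  have False if "cancels s p q" "cancels s p' q" "p < p'" for p p' q
    using that
  proof (induction q arbitrary: p p' rule: less_induct)
    case (less q)
    note p' = cancelsD[OF less.prems(2)]
    obtain r where r: "r < q" "cancels s p' r"
      using cancels_between_Open[OF less.prems(1,3) p'(1,3)] .
    obtain p'' where "p' < p''" "cancels s p'' r"
      using cancels_between_Close[OF less.prems(2) cancelsD(1)[OF r(2)] r(1) cancelsD(4)[OF r(2)]] .
    then show False using less.IH r by blast
  qed
  then show ?thesis using assms by (metis linorder_neqE_nat)
qed

text \<open>The nearer of two partners of \<open>p\<close> lies inside the wider pair, so it would
  have a second opening partner right of \<open>p\<close>.\<close>

lemma cancels_unique_close:
  assumes "cancels s p q" "cancels s p q'"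
  shows "q = q'"
proof -
  have False if q: "cancels s p q" "cancels s p q'" "q < q'" for q q'
  proof -
    obtain p' where "p < p'" "cancels s p' q"
      using cancels_between_Close[OF q(2) cancelsD(1)[OF q(1)] q(3) cancelsD(4)[OF q(1)]] .
    then show False using cancels_unique_open q(1) by blast
  qed
  then show ?thesis using assms by (metis linorder_neqE_nat)
qed

lemma canceled_if_between:
  assumes "cancels s p q" "p < r" "r < q"
  shows "canceled s r"
  using cancelsD(5)[OF assms] unfolding canceled_def by blast

text \<open>Induction on the distance: all brackets in between are canceled, as otherwise one of
  them would form a closer pair with \<open>p\<close> or \<open>q\<close>. But then \<open>p\<close>
  and \<open>q\<close> cancel each other.\<close>

lemma uncanceled_open_after_close:
  assumes "p < q" "q < length s" "fst (s ! p) = Open" "fst (s ! q) = Close"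
    and "\<not> canceled s p" "\<not> canceled s q"
  shows False
  using assms
proof (induction "q - p" arbitrary: p q rule: less_induct)
  case less
  have "cancels s p q"
  proof (rule cancels.intros)
    fix r assume r: "p < r" "r < q"
    have "canceled s r"
    proof (cases "fst (s ! r)")
      case Open
      then show ?thesis using less.hyps[of q r] less.prems r by force
    next
      case Close
      then show ?thesis using less.hyps[of r p] less.prems r by force
    qed
    then obtain r' where r': "cancels s r r' \<or> cancels s r' r"
      unfolding canceled_def by blast
    have "r' \<noteq> p" "r' \<noteq> q" using r' less.prems(5,6) unfolding canceled_def by blast+
    \<comment> \<open>A partner outside the interval would enclose \<open>p\<close> or
      \<open>q\<close> in a canceled pair and so make it canceled.\<close>
    moreover have "\<not> r' < p"
      using r' r less.prems(5) canceled_if_between[of s r' r p] cancelsD(1)[of s r r'] by auto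
    moreover have "\<not> q < r'"
      using r' r less.prems(6) canceled_if_between[of s r r' q] cancelsD(1)[of s r' r] by auto
    ultimately show "\<exists>r'. p < r' \<and> r' < q \<and> (cancels s r r' \<or> cancels s r' r)"
      using r' by (intro exI[of _ r']) auto
  qed (use less.prems in auto)
  then show False using less.prems(5) unfolding canceled_def by blast
qed

section \<open>Effect of prepending a bracket\<close>

lemma cancels_Cons: "cancels (x # s) (Suc p) (Suc q) \<longleftrightarrow> cancels s p q"
proof
  show "cancels s p q" if "cancels (x # s) (Suc p) (Suc q)" for p q
    using that
  proof (induction "Suc p" "Suc q" arbitrary: p q rule: cancels.induct)
    case (1 q p)
    show ?case
    proof (rule cancels.intros)
      fix r assume "q < r" "r < p"
      then obtain r' where r': "Suc q < r'" "r' < Suc p"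
        "(cancels (x # s) (Suc r) r' \<and> (\<forall>p q. Suc r = Suc p \<longrightarrow> r' = Suc q \<longrightarrow> cancels s p q))
         \<or> (cancels (x # s) r' (Suc r) \<and> (\<forall>p q. r' = Suc p \<longrightarrow> Suc r = Suc q \<longrightarrow> cancels s p q))"
        using 1(5)[of "Suc r"] by auto
      then obtain t where "r' = Suc t" by (metis less_imp_Suc_add)
      then show "\<exists>r'. q < r' \<and> r' < p \<and> (cancels s r r' \<or> cancels s r' r)"
        using r' by (intro exI[of _ t]) auto
    qed (use 1 in auto)
  qed
  show "cancels (x # s) (Suc p) (Suc q)" if "cancels s p q" for p q
    using that
  proof induction
    case (1 p q)
    show ?case
    proof (rule cancels.intros)
      fix r assume r: "Suc p < r" "r < Suc q"
      then obtain t where t: "r = Suc t" by (metis less_imp_Suc_add)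
      then obtain t' where "p < t'" "t' < q"
        "cancels (x # s) (Suc t) (Suc t') \<or> cancels (x # s) (Suc t') (Suc t)"
        using 1(5)[of t] r by auto
      then show "\<exists>r'. Suc p < r' \<and> r' < Suc q \<and> (cancels (x # s) r r' \<or> cancels (x # s) r' r)"
        using t by (intro exI[of _ "Suc t'"]) auto
    qed (use 1 in auto)
  qed
qed

lemma canceled_Cons_Suc:
  "canceled (x # s) (Suc p) \<longleftrightarrow> canceled s p \<or> cancels (x # s) 0 (Suc p)"
proof -
  have "\<not> cancels (x # s) (Suc p) 0" using cancelsD(1) by blast
  then show ?thesis unfolding canceled_def by (metis cancels_Cons not0_implies_Suc)
qed

lemma canceled_0E:
  assumes "canceled (x # s) 0"
  obtains q where "cancels (x # s) 0 (Suc q)"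
proof -
  obtain q where "cancels (x # s) 0 q"
    using assms cancelsD(1)[of "x # s" _ 0] unfolding canceled_def by blast
  then show ?thesis using that cancelsD(1)[of "x # s" 0 q] by (cases q) auto
qed

text \<open>These closing brackets are still available to opening brackets prepended on the
  left.\<close>

definition unmatched_closes :: "(bracket \<times> 'a) list \<Rightarrow> nat set" where
  "unmatched_closes s = {q. q < length s \<and> fst (s ! q) = Close \<and> \<not> canceled s q}"

lemma finite_unmatched_closes [simp]: "finite (unmatched_closes s)"
  unfolding unmatched_closes_def by simp

lemma unmatched_closes_Nil [simp]: "unmatched_closes [] = {}"
  unfolding unmatched_closes_def by simp

lemma unmatched_closes_Close:
  "unmatched_closes ((Close, a) # s) = insert 0 (Suc ` unmatched_closes s)"
proof -
  have *: "\<not> cancels ((Close, a) # s) 0 q" "\<not> cancels s' q 0" for q and s' :: "(bracket \<times> 'a) list"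
    using cancelsD(1) cancelsD(3)[of "(Close, a) # s" 0] by auto
  then have "\<not> canceled ((Close, a) # s) 0" unfolding canceled_def by blast
  then show ?thesis
    unfolding unmatched_closes_def using *
    by (auto simp: canceled_Cons_Suc image_iff less_Suc_eq_0_disj)
qed

text \<open>The new bracket uses up one available closing bracket. That \<open>q\<close> was
  available follows from the uniqueness of its partner; all other cancellations are those of the
  tail.\<close>

lemma unmatched_closes_Open:
  assumes "cancels ((Open, a) # s) 0 (Suc q)"
  shows "q \<in> unmatched_closes s"
    "unmatched_closes ((Open, a) # s) = Suc ` (unmatched_closes s - {q})"
proof -
  have q: "q < length s" "fst (s ! q) = Close"
    using cancelsD(2,4)[OF assms] by auto
  have "\<not> canceled s q"
  proof
    assume "canceled s q"
    then obtain p where "cancels s p q" using cancelsD(3) q unfolding canceled_def by fastforce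
    then show False using assms cancels_Cons cancels_unique_open by blast
  qed
  then show "q \<in> unmatched_closes s" unfolding unmatched_closes_def using q by simp
  have q': "cancels ((Open, a) # s) 0 (Suc p) \<longleftrightarrow> p = q" for p
    using assms cancels_unique_close by blast
  show "unmatched_closes ((Open, a) # s) = Suc ` (unmatched_closes s - {q})" (is "?L = ?R")
  proof (rule set_eqI)
    fix p
    show "p \<in> ?L \<longleftrightarrow> p \<in> ?R"
      by (cases p) (auto simp: unmatched_closes_def canceled_Cons_Suc q' image_iff)
  qed
qed

lemma canceled_Open_iff: "canceled ((Open, a) # s) 0 \<longleftrightarrow> unmatched_closes s \<noteq> {}"
proof
  assume "canceled ((Open, a) # s) 0"
  then obtain q where "cancels ((Open, a) # s) 0 (Suc q)"
    by (rule canceled_0E)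
  then show "unmatched_closes s \<noteq> {}" using unmatched_closes_Open(1)[of a s q] by auto
next
  assume "unmatched_closes s \<noteq> {}"
  then obtain q where q: "q < length s" "fst (s ! q) = Close" "\<not> canceled s q"
    unfolding unmatched_closes_def by blast
  show "canceled ((Open, a) # s) 0"
  proof (rule ccontr)
    assume c: "\<not> canceled ((Open, a) # s) 0"
    \<comment> \<open>An uncanceled head takes part in no cancellation, so \<open>q\<close> stays
      uncanceled although an uncanceled opening bracket precedes it.\<close>
    then have "\<not> canceled ((Open, a) # s) (Suc q)"
      using q(3) unfolding canceled_Cons_Suc by (auto simp: canceled_def)
    then show False
      using uncanceled_open_after_close[of 0 "Suc q" "(Open, a) # s"] q c by simp
  qed
qed

section \<open>Cancellation as a recursion from the right\<close>

fun num_closes :: "(bracket \<times> 'a) list \<Rightarrow> nat" where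
  "num_closes [] = 0"
| "num_closes ((Close, _) # s) = Suc (num_closes s)"
| "num_closes ((Open, _) # s) = num_closes s - 1"

text \<open>An opening bracket survives exactly if no closing bracket to its right is left over, and
  then it precedes all later survivors.\<close>

fun first_open :: "(bracket \<times> 'a) list \<Rightarrow> 'a option" where
  "first_open [] = None"
| "first_open ((Close, _) # s) = first_open s"
| "first_open ((Open, a) # s) = (if num_closes s = 0 then Some a else first_open s)"

text \<open>A prepended opening bracket removes one available closing bracket if there is one; the
  truncated subtraction covers the other case.\<close>

lemma card_unmatched_closes: "card (unmatched_closes s) = num_closes s"
proof (induction s rule: num_closes.induct)
  case (2 a s)
  then show ?case by (simp add: unmatched_closes_Close card_image)
next
  case (3 a s)
  show ?case
  proof (cases "canceled ((Open, a) # s) 0")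
    case True
    then obtain q where "cancels ((Open, a) # s) 0 (Suc q)"
      by (rule canceled_0E)
    then have "card (unmatched_closes ((Open, a) # s)) = card (unmatched_closes s) - 1"
      using unmatched_closes_Open[of a s q] by (simp add: card_image)
    then show ?thesis using 3 by simp
  next
    case False
    then have e: "unmatched_closes s = {}" using canceled_Open_iff[of a s] by simp
    have "p \<notin> unmatched_closes ((Open, a) # s)" for p
    proof (cases p)
      case (Suc q)
      have "\<not> (q < length s \<and> fst (s ! q) = Close \<and> \<not> canceled s q)"
        using e unfolding unmatched_closes_def by blast
      then show ?thesis using Suc by (simp add: unmatched_closes_def canceled_Cons_Suc)
    qed (simp add: unmatched_closes_def)
    then have "unmatched_closes ((Open, a) # s) = {}" by blast
    then show ?thesis using 3 e by simp
  qed
qed simp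

text \<open>Prepending an opening bracket changes the status of the tail only at a closing bracket,
  which \<open>leftmost_open\<close> does not see.\<close>

lemma leftmost_open_nths_cong:
  assumes "\<And>p. p < length s \<Longrightarrow> fst (s ! p) = Open \<Longrightarrow> p \<in> A \<longleftrightarrow> p \<in> B"
  shows "leftmost_open (nths s A) = leftmost_open (nths s B)"
  using assms
proof (induction s arbitrary: A B)
  case (Cons x s)
  have "leftmost_open (nths s {j. Suc j \<in> A}) = leftmost_open (nths s {j. Suc j \<in> B})"
    using Cons.prems by (intro Cons.IH) force
  moreover have "fst x = Open \<Longrightarrow> 0 \<in> A \<longleftrightarrow> 0 \<in> B" using Cons.prems[of 0] by simp
  ultimately show ?case by (auto simp: nths_Cons leftmost_open_def)
qed simp

lemma leftmost_open_uncanceled: "leftmost_open (uncanceled s) = first_open s"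
proof (induction s rule: first_open.induct)
  case 1
  then show ?case by (simp add: uncanceled_def leftmost_open_def)
next
  case (2 a s)
  have "\<not> cancels ((Close, a) # s) 0 q" for q
    using cancelsD(3)[of "(Close, a) # s" 0] by auto
  then show ?case
    using 2 by (simp add: uncanceled_def leftmost_open_def nths_Cons canceled_Cons_Suc)
next
  case (3 a s)
  have "\<not> cancels ((Open, a) # s) 0 (Suc q)" if "fst (s ! q) = Open" for q
    using cancelsD(4)[of "(Open, a) # s" 0 "Suc q"] that by auto
  then have "leftmost_open (nths s {j. \<not> canceled ((Open, a) # s) (Suc j)}) =
    leftmost_open (uncanceled s)"
    unfolding uncanceled_def
    by (intro leftmost_open_nths_cong) (auto simp: canceled_Cons_Suc)
  moreover have "canceled ((Open, a) # s) 0 \<longleftrightarrow> num_closes s \<noteq> 0"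
    by (simp add: canceled_Open_iff flip: card_unmatched_closes)
  ultimately show ?case
    using 3 by (auto simp: uncanceled_def leftmost_open_def nths_Cons)
qed

section \<open>Runs of equal brackets\<close>

lemma num_closes_Open_append [simp]:
  "num_closes (map (Pair Open) xs @ s) = num_closes s - length xs"
  by (induction xs) auto

lemma num_closes_Close_append [simp]:
  "num_closes (map (Pair Close) xs @ s) = num_closes s + length xs"
  by (induction xs) auto

text \<open>The closing brackets left over in \<open>s\<close> cancel the run from its right end, so
  its head survives if any bracket of it does.\<close>

lemma first_open_Open_append [simp]:
  "first_open (map (Pair Open) xs @ s) =
    (if num_closes s < length xs then Some (hd xs) else first_open s)"
  by (induction xs) auto

lemma first_open_Close_append [simp]:
  "first_open (map (Pair Close) xs @ s) = first_open s"
  by (induction xs) auto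

text \<open>
  Adding \<open>p\<close> to the lengths of a run of opening brackets and of the run of closing brackets right
  after it does not change what remains after cancellation.
\<close>

lemma first_open_blocks:
  assumes "\<And>r. r < R \<Longrightarrow> length (B' r) = length (B r) + p r"
    and "\<And>r. r < R \<Longrightarrow> length (A' r) = length (A r) + p r"
    and "s = concat (map (\<lambda>r. map (Pair Open) (B r) @ map (Pair Close) (A r)) (rev [0..<R]))"
    and "s' = concat (map (\<lambda>r. map (Pair Open) (B' r) @ map (Pair Close) (A' r)) (rev [0..<R]))"
  shows "num_closes s = num_closes s' \<and>
    rel_option (\<lambda>x y. \<exists>r<R. B r \<noteq> [] \<and> B' r \<noteq> [] \<and> x = hd (B r) \<and> y = hd (B' r))
      (first_open s) (first_open s')"
  using assms
proof (induction R arbitrary: s s')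
  case (Suc R)
  define t where "t = concat (map (\<lambda>r. map (Pair Open) (B r) @ map (Pair Close) (A r)) (rev [0..<R]))"
  define t' where "t' = concat (map (\<lambda>r. map (Pair Open) (B' r) @ map (Pair Close) (A' r)) (rev [0..<R]))"
  have IH: "num_closes t = num_closes t'"
    "rel_option (\<lambda>x y. \<exists>r<R. B r \<noteq> [] \<and> B' r \<noteq> [] \<and> x = hd (B r) \<and> y = hd (B' r))
      (first_open t) (first_open t')"
    using Suc.IH[OF _ _ t_def t'_def] Suc.prems(1,2) by auto
  have s: "s = map (Pair Open) (B R) @ map (Pair Close) (A R) @ t"
    and s': "s' = map (Pair Open) (B' R) @ map (Pair Close) (A' R) @ t'"
    using Suc.prems(3,4) by (simp_all add: t_def t'_def)
  have lens: "length (B' R) = length (B R) + p R" "length (A' R) = length (A R) + p R"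
    using Suc.prems(1,2) by auto
  show ?case
  \<comment> \<open>The question is whether the run \<open>B R\<close> outlasts the closing brackets
    to its right. Both sides of the comparison grow by \<open>p R\<close> when passing to
    \<open>s'\<close>.\<close>
  proof (cases "num_closes t + length (A R) < length (B R)")
    case True
    then have "B R \<noteq> []" "B' R \<noteq> []" using lens(1) by auto
    then show ?thesis using True lens IH(1) by (auto simp: s s')
  next
    case False
    have "rel_option (\<lambda>x y. \<exists>r<Suc R. B r \<noteq> [] \<and> B' r \<noteq> [] \<and> x = hd (B r) \<and> y = hd (B' r))
      (first_open t) (first_open t')"
      by (rule option.rel_mono_strong[OF IH(2)]) (auto intro: less_SucI)
    then show ?thesis using False lens IH(1) by (simp add: s s')
  qed
qed simp

section \<open>The bracket string of a multisegment\<close>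

text \<open>\<open>[r + 1, i]\<close> and \<open>[r, i - 1]\<close> have the same height
  \<open>i - r\<close>, and the larger bottom entry comes first. So increasing height means
  decreasing \<open>r\<close>, with the opening brackets of each height before the closing
  ones.\<close>

lemma seg_string_eq:
  assumes "M \<in> MS n" "i \<ge> 1"
  shows "seg_string i M = concat (map (\<lambda>r. map (Pair Open) (replicate (count M (Suc r, i)) (Suc r, i))
      @ map (Pair Close) (replicate (count M (r, i - 1)) (r, i - 1))) (rev [0..<i]))"
proof -
  define block where "block r = replicate (count M (Suc r, i)) (Suc r, i)
      @ replicate (count M (r, i - 1)) (r, i - 1)" for r
  define ys where "ys = concat (map block (rev [0..<i]))"
  define P where "P x \<longleftrightarrow> snd x = i - 1 \<or> snd x = i" for x :: segment
  define xs where "xs = ordered_segments M"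
  have xs: "mset xs = M" "sorted_wrt seg_le xs"
    using theI'[OF ex1_ordered_segments[OF assms(1)]] unfolding xs_def ordered_segments_def by auto
  have seg: "is_segment x" if "x \<in># M" for x using assms(1) that by (auto simp: MS_def)
  \<comment> \<open>The pair \<open>(0, i - 1)\<close> in block 0 is no segment and has multiplicity
    zero; pairs with \<open>j < h\<close> account for bottom entries outside the range of the
    blocks.\<close>
  have M0: "count M (0, j) = 0" "j < h \<Longrightarrow> count M (h, j) = 0" for h j
    using seg[of "(0, j)"] seg[of "(h, j)"]
    by (auto simp: is_segment_def simp flip: not_in_iff)
  have "sorted_wrt seg_le (concat (map block (rev [0..<R])))" if "R \<le> i" for R
    using that
  proof (induction R)
    case (Suc R)
    have "seg_le (Suc R, i) (R, i - 1)" if "(R, i - 1) \<in># M"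
      using Suc.prems seg[OF that] by (auto simp: seg_le_def height_def is_segment_def)
    moreover have "sorted_wrt seg_le (replicate k x)" for k x
      by (induction k) (auto simp: seg_le_def)
    ultimately have "sorted_wrt seg_le (block R)"
      by (auto simp: block_def sorted_wrt_append)
    moreover have "seg_le x y" if "x \<in> set (block R)" "r < R" "y \<in> set (block r)" for x y r
      using that Suc.prems assms(2) seg[of x] seg[of y]
      by (auto simp: block_def seg_le_def height_def is_segment_def split: if_splits)
    ultimately show ?case using Suc by (auto simp: sorted_wrt_append)
  qed simp
  then have sorted: "sorted_wrt seg_le ys" unfolding ys_def by blast
  \<comment> \<open>Block \<open>r\<close> has closing segments with bottom \<open>r\<close> but
    opening ones with bottom \<open>Suc r\<close>, hence the two ranges of \<open>h\<close>.\<close>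
  have "count (mset (concat (map block (rev [0..<R])))) (h, j) =
    (if h < R then (if j = i - 1 then count M (h, j) else 0) else 0)
    + (if 0 < h \<and> h \<le> R \<and> j = i then count M (h, j) else 0)" for R h j
    using assms(2) by (induction R) (auto simp: block_def M0 not_less_eq less_Suc_eq le_Suc_eq)
  from this[of i] have "count (mset ys) x = count (filter_mset P M) x" for x
    using assms(2) M0 by (cases x) (auto simp: P_def not_less simp flip: ys_def)
  then have "mset ys = filter_mset P M" by (rule multiset_eqI)
  moreover have "filter_mset P M \<in> MS n" using assms(1) by (auto simp: MS_def)
  moreover have "mset (filter P xs) = filter_mset P M" "sorted_wrt seg_le (filter P xs)"
    using xs by (auto simp: sorted_wrt_filter)
  \<comment> \<open>Both lists are ordered arrangements of the segments that give brackets, so the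
    uniqueness of the order applies to \<open>filter_mset P M\<close>.\<close>
  ultimately have "filter P xs = ys" using ex1_ordered_segments sorted by blast
  moreover have "concat (map (seg_brackets i) zs) = concat (map (seg_brackets i) (filter P zs))" for zs
    by (induction zs) (auto simp: seg_brackets_def P_def)
  ultimately have "seg_string i M = concat (map (seg_brackets i) ys)"
    unfolding seg_string_def xs_def by metis
  moreover have "concat (map (seg_brackets i) (replicate k (h, i))) = replicate k (Open, (h, i))"
    "concat (map (seg_brackets i) (replicate k (h, i - 1))) = replicate k (Close, (h, i - 1))" for k h
    using assms(2) by (induction k) (auto simp: seg_brackets_def)
  then have "concat (map (seg_brackets i) (block r)) = map (Pair Open) (replicate (count M (Suc r, i)) (Suc r, i))
      @ map (Pair Close) (replicate (count M (r, i - 1)) (r, i - 1))" for r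
    by (simp add: block_def map_replicate)
  then have "concat (map (seg_brackets i) (concat (map block rs))) =
     concat (map (\<lambda>r. map (Pair Open) (replicate (count M (Suc r, i)) (Suc r, i))
      @ map (Pair Close) (replicate (count M (r, i - 1)) (r, i - 1))) rs)" for rs
    by (induction rs) auto
  ultimately show ?thesis unfolding ys_def by simp
qed

section \<open>The bracket string of a tableau\<close>

lemma count_mset_card: "count (mset xs) x = card {c. c < length xs \<and> xs ! c = x}"
proof -
  have "{c. c < length xs \<and> xs ! c = x} = {c. c < length xs \<and> x = xs ! c}" by auto
  then show ?thesis by (simp add: count_mset count_list_eq_length_filter length_filter_conv_card)
qed

lemma count_psi:
  "count (psi b) (h, j) = (if 1 \<le> h \<and> h \<le> j then card {c. entry_at b (h - 1) c j} else 0)"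
proof -
  have "count (image_mset (\<lambda>j. (r, j)) N) (h, j) = (if r = h then count N j else 0)" for r N
    by (induction N) auto
  then have row: "count (image_mset (\<lambda>j. (Suc r, j)) (filter_mset (\<lambda>j. Suc r \<le> j) (mset (b ! r)))) (h, j)
      = (if r = h - 1 then if 1 \<le> h \<and> h \<le> j then count (mset (b ! r)) j else 0 else 0)" for r
    by auto
  show ?thesis
    unfolding psi_def count_sum row by (simp add: sum.delta entry_at_def count_mset_card)
qed

lemma psi_in_MS:
  assumes "b \<in> SSYT n l"
  shows "psi b \<in> MS n"
proof -
  have "1 \<le> h \<and> h \<le> j \<and> j \<le> n" if "(h, j) \<in># psi b" for h j
  proof -
    have "count (psi b) (h, j) \<noteq> 0" using that by simp
    then have h: "1 \<le> h" "h \<le> j" "card {c. entry_at b (h - 1) c j} \<noteq> 0"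
      unfolding count_psi by presburger+
    then have "{c. entry_at b (h - 1) c j} \<noteq> {}" by (metis card.empty)
    then obtain c where "h - 1 < length b" "j \<in> set (b ! (h - 1))"
      by (auto simp: entry_at_def)
    moreover from this(1) have "b ! (h - 1) \<in> set b" by simp
    ultimately show ?thesis using h assms by (fastforce simp: SSYT_def)
  qed
  then show ?thesis by (auto simp: MS_def is_segment_def)
qed

section \<open>Entries in the rows and columns of a tableau\<close>

locale tableau =
  fixes n :: nat and l :: "nat list" and b :: "nat list list"
  assumes partition: "is_partition l" and SSYT: "b \<in> SSYT n l"
begin

lemma shape: "map length b = l"
  using SSYT by (simp add: SSYT_def)

lemma length_row: "r < length b \<Longrightarrow> length (b ! r) = l ! r"
  using shape by auto

lemma row_length_mono:
  assumes "r \<le> r'" "r' < length b"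
  shows "length (b ! r') \<le> length (b ! r)"
proof (cases "r = r'")
  case False
  moreover have "length b = length l" using shape by auto
  ultimately have "l ! r' \<le> l ! r"
    using assms partition unfolding is_partition_def sorted_wrt_iff_nth_less by simp
  then show ?thesis using assms length_row by simp
qed simp

lemma entry_row_mono:
  assumes "entry_at b r c x" "entry_at b r c' x'" "c \<le> c'"
  shows "x \<le> x'"
proof -
  have "sorted (b ! r)" using assms(1) SSYT by (simp add: SSYT_def entry_at_def)
  then show ?thesis using assms sorted_nth_mono by (auto simp: entry_at_def)
qed

text \<open>No row is longer than the row above it, so a column continues up to the top row, and the
  entry drops by at least one at each step upwards.\<close>

lemma entry_above:
  assumes "entry_at b r' c x'" "r \<le> r'"
  obtains x where "entry_at b r c x" "x + (r' - r) \<le> x'"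
proof -
  have "\<exists>x. entry_at b r c x \<and> x + (r' - r) \<le> x'"
    using assms(2,1)
  proof (induction r rule: inc_induct)
    case base
    then show ?case by auto
  next
    case (step r)
    then obtain x where x: "entry_at b (Suc r) c x" "x + (r' - Suc r) \<le> x'" by blast
    have "c < length (b ! r)" using x row_length_mono[of r "Suc r"] by (auto simp: entry_at_def)
    moreover have "b ! r ! c < x" using x SSYT by (auto simp: entry_at_def SSYT_def)
    ultimately show ?case
      using x step.hyps by (intro exI[of _ "b ! r ! c"]) (auto simp: entry_at_def)
  qed
  then show ?thesis using that by blast
qed

lemma entry_unique:
  "entry_at b r c x \<Longrightarrow> entry_at b r c x' \<Longrightarrow> x = x'"
  by (simp add: entry_at_def)

lemma entry_less:
  assumes "entry_at b r c x" "entry_at b r' c x'" "r < r'"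
  shows "x + (r' - r) \<le> x'"
proof -
  obtain y where "entry_at b r c y" "y + (r' - r) \<le> x'"
    using entry_above[OF assms(2), of r] assms(3) by auto
  then show ?thesis using entry_unique[OF assms(1)] by simp
qed

lemma entry_unique_row: "entry_at b r c x \<Longrightarrow> entry_at b r' c x \<Longrightarrow> r = r'"
  using entry_less[of r c x r' x] entry_less[of r' c x r x] by (cases r r' rule: linorder_cases) auto

lemma row_le_entry: "entry_at b r c x \<Longrightarrow> r \<le> x"
  by (erule entry_above[of r c x 0]) auto

lemma entry_column: "entry_at b r c x \<Longrightarrow> c < num_columns b"
  using row_length_mono[of 0 r] by (cases b) (auto simp: entry_at_def num_columns_def)

text \<open>A strictly increasing column has no room between \<open>x\<close> and
  \<open>Suc x\<close>, so the two entries are vertically adjacent.\<close>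

lemma in_column_pred_iff:
  assumes "entry_at b r c (Suc x)"
  shows "in_column b c x \<longleftrightarrow> r > 0 \<and> entry_at b (r - 1) c x"
proof
  assume "in_column b c x"
  then obtain r' where r': "entry_at b r' c x" by (auto simp: in_column_def)
  have "r' < r"
    using entry_less[OF assms r'] assms r' by (cases r r' rule: linorder_cases) (auto simp: entry_at_def)
  moreover have "r - r' \<le> 1" using entry_less[OF r' assms] \<open>r' < r\<close> by simp
  ultimately show "r > 0 \<and> entry_at b (r - 1) c x" using r' \<open>r' < r\<close> by (cases r) (auto simp: less_Suc_eq)
qed (auto simp: in_column_def)

lemma in_column_Suc_iff:
  assumes "entry_at b r c x"
  shows "in_column b c (Suc x) \<longleftrightarrow> entry_at b (Suc r) c (Suc x)"
proof
  assume "in_column b c (Suc x)"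
  then obtain r' where r': "entry_at b r' c (Suc x)" by (auto simp: in_column_def)
  moreover have "in_column b c x" using assms by (auto simp: in_column_def)
  ultimately have "r' > 0" "entry_at b (r' - 1) c x" using in_column_pred_iff by auto
  then have "r' = Suc r" using entry_unique_row[OF assms] by force
  then show "entry_at b (Suc r) c (Suc x)" using r' by simp
qed (auto simp: in_column_def)

section \<open>The columns with a bracket, split by the row of the entry causing it
  (\<open>x\<close> stands for \<open>i - 1\<close>)\<close>

definition opens :: "nat \<Rightarrow> nat \<Rightarrow> nat list" where
  "opens x r = filter (\<lambda>c. entry_at b r c (Suc x) \<and> \<not> in_column b c x) [0..<num_columns b]"

definition closes :: "nat \<Rightarrow> nat \<Rightarrow> nat list" where
  "closes x r = filter (\<lambda>c. entry_at b r c x \<and> \<not> in_column b c (Suc x)) [0..<num_columns b]"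

lemma set_opens: "set (opens x r) = {c. entry_at b r c (Suc x) \<and> \<not> in_column b c x}"
  using entry_column by (auto simp: opens_def)

lemma set_closes: "set (closes x r) = {c. entry_at b r c x \<and> \<not> in_column b c (Suc x)}"
  using entry_column by (auto simp: closes_def)

lemma sorted_opens: "sorted_wrt (<) (opens x r)" and sorted_closes: "sorted_wrt (<) (closes x r)"
  by (simp_all add: opens_def closes_def sorted_wrt_filter)

text \<open>In row \<open>r\<close>, column \<open>c\<close> has a value below \<open>x\<close>,
  whereas column \<open>c'\<close> has \<open>x\<close> or \<open>Suc x\<close>. Weakly increasing
  rows force \<open>c < c'\<close>.\<close>

lemma lower_row_before:
  assumes "c \<in> set (closes x r') \<union> set (opens x r')" "c' \<in> set (closes x r) \<union> set (opens x r)"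
    and "r < r'"
  shows "c < c'"
proof (rule ccontr)
  assume "\<not> c < c'"
  obtain y' where y': "entry_at b r' c y'" "y' = x \<or> y' = Suc x \<and> \<not> in_column b c x"
    using assms(1) by (auto simp: set_opens set_closes)
  obtain y where y: "entry_at b r c' y" "x \<le> y"
    using assms(2) by (auto simp: set_opens set_closes)
  obtain z where z: "entry_at b r c z" "z + (r' - r) \<le> y'"
    using entry_above[OF y'(1), of r] assms(3) by auto
  have "z < x"
  proof (cases "y' = x")
    case False
    \<comment> \<open>For \<open>y' = Suc x\<close> the value \<open>z\<close> is at most
      \<open>x\<close>, and \<open>x\<close> itself is excluded because the column carries an
      opening bracket.\<close>
    then have "z \<noteq> x" using y'(2) z(1) by (auto simp: in_column_def)
    then show ?thesis using False y'(2) z(2) assms(3) by auto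
  qed (use z(2) assms(3) in simp)
  then show False using entry_row_mono[OF y(1) z(1)] y(2) \<open>\<not> c < c'\<close> by simp
qed

text \<open>An entry \<open>Suc x\<close> in row \<open>Suc x\<close> has \<open>x\<close> directly
  above it, since entries of row \<open>x\<close> are at least \<open>x\<close>. Hence its column
  carries no opening bracket.\<close>

lemma opens_closes_row:
  assumes "c \<in> set (closes x r) \<union> set (opens x r)"
  shows "r \<le> x"
proof -
  have "r \<noteq> Suc x" if o: "entry_at b r c (Suc x)" "\<not> in_column b c x"
  proof
    assume "r = Suc x"
    then obtain y where y: "entry_at b x c y" "y + (r - x) \<le> Suc x"
      using entry_above[OF o(1), of x] by auto
    then have "y = x" using row_le_entry[OF y(1)] \<open>r = Suc x\<close> by simp
    then show False using y(1) o(2) by (auto simp: in_column_def)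
  qed
  then show ?thesis using assms row_le_entry by (fastforce simp: set_opens set_closes le_Suc_eq)
qed

text \<open>Within a row the entries \<open>x\<close> precede the entries \<open>Suc x\<close>, and
  lower rows come first by \<open>lower_row_before\<close>. So two strictly increasing lists of
  columns with the same elements are compared.\<close>

lemma col_string_eq:
  "col_string (Suc x) b =
    concat (map (\<lambda>r. map (Pair Close) (closes x r) @ map (Pair Open) (opens x r)) (rev [0..<Suc x]))"
proof -
  define block where "block r = closes x r @ opens x r" for r
  define cols where "cols = filter (\<lambda>c. col_brackets (Suc x) b c \<noteq> []) [0..<num_columns b]"
  have block_sorted: "sorted_wrt (<) (block r)" for r
  proof -
    have "c < c'" if "c \<in> set (closes x r)" "c' \<in> set (opens x r)" for c c'
      using that entry_row_mono[of r c' "Suc x" c x] by (force simp: set_opens set_closes)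
    then show ?thesis unfolding block_def sorted_wrt_append using sorted_opens sorted_closes by blast
  qed
  have "sorted_wrt (<) (concat (map block (rev [0..<R])))" for R
  proof (induction R)
    case (Suc R)
    have "c < c'" if "c \<in> set (block R)" "r < R" "c' \<in> set (block r)" for c c' r
      using lower_row_before that unfolding block_def by simp
    then show ?case using Suc block_sorted by (auto simp: sorted_wrt_append)
  qed simp
  moreover have "sorted_wrt (<) cols" unfolding cols_def by (simp add: sorted_wrt_filter)
  moreover have "set cols = set (concat (map block (rev [0..<Suc x])))" (is "_ = ?S")
  proof (rule set_eqI)
    fix c
    have "c \<in> set cols \<longleftrightarrow> c < num_columns b \<and> in_column b c x \<noteq> in_column b c (Suc x)"
      by (auto simp: cols_def col_brackets_def)
    also have "\<dots> \<longleftrightarrow> (\<exists>r. c \<in> set (block r))"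
      using entry_column by (auto simp: block_def set_opens set_closes in_column_def)
    also have "\<dots> \<longleftrightarrow> (\<exists>r\<le>x. c \<in> set (block r))"
      using opens_closes_row[of c x] by (auto simp: block_def)
    also have "\<dots> \<longleftrightarrow> c \<in> ?S"
      by (auto simp: less_Suc_eq_le simp del: upt_Suc)
    finally show "c \<in> set cols \<longleftrightarrow> c \<in> ?S" .
  qed
  ultimately have cols: "cols = concat (map block (rev [0..<Suc x]))"
    using strict_sorted_equal by blast
  have "concat (map (col_brackets (Suc x) b) cs) =
      concat (map (col_brackets (Suc x) b) (filter (\<lambda>c. col_brackets (Suc x) b c \<noteq> []) cs))" for cs
    by (induction cs) auto
  then have col: "col_string (Suc x) b = concat (map (col_brackets (Suc x) b) (concat (map block (rev [0..<Suc x]))))"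
    unfolding col_string_def cols[symmetric] cols_def by blast
  have opn: "concat (map (col_brackets (Suc x) b) cs) = map (Pair Open) cs"
    if "set cs \<subseteq> set (opens x r)" for cs r
    using that by (induction cs) (auto simp: set_opens in_column_def col_brackets_def)
  have cls: "concat (map (col_brackets (Suc x) b) cs) = map (Pair Close) cs"
    if "set cs \<subseteq> set (closes x r)" for cs r
    using that by (induction cs) (auto simp: set_closes in_column_def col_brackets_def)
  have "concat (map (col_brackets (Suc x) b) (block r)) =
      map (Pair Close) (closes x r) @ map (Pair Open) (opens x r)" for r
    unfolding block_def map_append concat_append opn[OF subset_refl] cls[OF subset_refl] ..
  then have "concat (map (col_brackets (Suc x) b) (concat (map block rs))) =
      concat (map (\<lambda>r. map (Pair Close) (closes x r) @ map (Pair Open) (opens x r)) rs)" for rs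
    by (induction rs) auto
  then show ?thesis unfolding col .
qed

text \<open>Each \<open>Suc x\<close> in row \<open>r\<close> either gives an opening bracket or
  lies directly under an \<open>x\<close>; the top row has nothing above it.\<close>

lemma length_opens:
  "card {c. entry_at b r c (Suc x)} = length (opens x r) +
    (if r = 0 then 0 else card {c. entry_at b (r - 1) c x \<and> entry_at b r c (Suc x)})"
proof -
  have "card {c. entry_at b r c (Suc x)} = card (set (opens x r) \<union>
    (if r = 0 then {} else {c. entry_at b (r - 1) c x \<and> entry_at b r c (Suc x)}))"
    using in_column_pred_iff by (intro arg_cong[of _ _ card]) (auto simp: set_opens)
  moreover have "\<dots> = card (set (opens x r)) +
    card (if r = 0 then {} else {c. entry_at b (r - 1) c x \<and> entry_at b r c (Suc x)})"
    using in_column_pred_iff by (intro card_Un_disjoint) (auto simp: set_opens entry_at_def)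
  moreover have "distinct (opens x r)" by (simp add: opens_def)
  ultimately show ?thesis by (simp add: distinct_card)
qed

text \<open>The vertical pairs subtracted from row \<open>r\<close> here are those subtracted from
  row \<open>Suc r\<close> in \<open>length_opens\<close>; their number serves as \<open>p\<close>
  in \<open>first_open_blocks\<close>.\<close>

lemma length_closes:
  "card {c. entry_at b r c x} =
    length (closes x r) + card {c. entry_at b r c x \<and> entry_at b (Suc r) c (Suc x)}"
proof -
  have "card {c. entry_at b r c x} =
    card (set (closes x r) \<union> {c. entry_at b r c x \<and> entry_at b (Suc r) c (Suc x)})"
    using in_column_Suc_iff by (intro arg_cong[of _ _ card]) (auto simp: set_closes)
  moreover have "\<dots> = card (set (closes x r)) + card {c. entry_at b r c x \<and> entry_at b (Suc r) c (Suc x)}"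
    using in_column_Suc_iff by (intro card_Un_disjoint) (auto simp: set_closes entry_at_def)
  moreover have "distinct (closes x r)" by (simp add: closes_def)
  ultimately show ?thesis by (simp add: distinct_card)
qed

lemma first_open_strings:
  "rel_option (\<lambda>c y. \<exists>r\<le>x. opens x r \<noteq> [] \<and> c = hd (opens x r) \<and> y = (Suc r, Suc x))
    (first_open (col_string (Suc x) b)) (first_open (seg_string (Suc x) (psi b)))"
proof -
  \<comment> \<open>In both strings the closing brackets that follow the opening ones of row
    \<open>r\<close> belong to row \<open>r - 1\<close>. The empty \<open>A 0\<close> matches the
    absence of segments with bottom 0.\<close>
  define A where "A r = (if r = 0 then [] else closes x (r - 1))" for r
  define B' where "B' r = replicate (count (psi b) (Suc r, Suc x)) (Suc r, Suc x)" for r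
  define A' where "A' r = replicate (count (psi b) (r, x)) (r, x)" for r
  define p where
    "p r = (if r = 0 then 0 else card {c. entry_at b (r - 1) c x \<and> entry_at b r c (Suc x)})" for r
  define s where
    "s = concat (map (\<lambda>r. map (Pair Open) (opens x r) @ map (Pair Close) (A r)) (rev [0..<Suc x]))"
  \<comment> \<open>Shifting the block boundaries leaves the closing brackets of row
    \<open>R\<close> in front, where they do not affect the first uncanceled opening
    bracket.\<close>
  have "concat (map (\<lambda>r. map (Pair Close) (closes x r) @ map (Pair Open) (opens x r)) (rev [0..<Suc R]))
    = map (Pair Close) (closes x R) @
      concat (map (\<lambda>r. map (Pair Open) (opens x r) @ map (Pair Close) (A r)) (rev [0..<Suc R]))" for R
    by (induction R) (simp_all add: A_def)
  then have "first_open (col_string (Suc x) b) = first_open s"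
    unfolding col_string_eq s_def by (simp del: upt_Suc)
  moreover have "seg_string (Suc x) (psi b) =
    concat (map (\<lambda>r. map (Pair Open) (B' r) @ map (Pair Close) (A' r)) (rev [0..<Suc x]))"
    using seg_string_eq[OF psi_in_MS[OF SSYT], of "Suc x"]
    unfolding A'_def B'_def by (simp del: upt_Suc)
  moreover have "length (B' r) = length (opens x r) + p r" if "r < Suc x" for r
    using that length_opens[of r x] by (simp add: B'_def p_def count_psi)
  moreover have "length (A' r) = length (A r) + p r" if "r < Suc x" for r
    using that length_closes[of "r - 1" x] by (auto simp: A'_def A_def p_def count_psi)
  ultimately have "rel_option
      (\<lambda>c y. \<exists>r<Suc x. opens x r \<noteq> [] \<and> B' r \<noteq> [] \<and> c = hd (opens x r) \<and> y = hd (B' r))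
      (first_open (col_string (Suc x) b)) (first_open (seg_string (Suc x) (psi b)))"
    using first_open_blocks[of "Suc x" B' "opens x" p A' A s] s_def by simp
  then show ?thesis
    by (rule option.rel_mono_strong) (auto simp: B'_def less_Suc_eq_le)
qed

section \<open>The crystal operator on tableaux\<close>

context
  fixes x r c :: nat
  assumes opens_nonempty: "opens x r \<noteq> []" and c: "c = hd (opens x r)"
begin

lemma changed_entry: "entry_at b r c (Suc x)" "\<not> in_column b c x"
  using opens_nonempty c hd_in_set[of "opens x r"] set_opens by auto

text \<open>A \<open>Suc x\<close> left of column \<open>c\<close> in row \<open>r\<close> would
  give no opening bracket, because \<open>c\<close> is the first column of the row that does. So it
  lies under an \<open>x\<close>, and row \<open>r - 1\<close> then forces an \<open>x\<close> above
  the changed cell, which column \<open>c\<close> excludes.\<close>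

lemma entry_left_of_changed:
  assumes "entry_at b r c' y" "c' < c"
  shows "y \<le> x"
proof (rule ccontr)
  assume "\<not> y \<le> x"
  then have y: "y = Suc x"
    using entry_row_mono[OF assms(1) changed_entry(1)] assms(2) by simp
  have "c' \<notin> set (opens x r)"
    using sorted_opens[of x r] opens_nonempty c assms(2) by (cases "opens x r") auto
  then have "in_column b c' x" using assms(1) y by (auto simp: set_opens)
  then have r: "r > 0" and c': "entry_at b (r - 1) c' x"
    using in_column_pred_iff assms(1) y by auto
  obtain z where z: "entry_at b (r - 1) c z" "z + (r - (r - 1)) \<le> Suc x"
    using entry_above[OF changed_entry(1), of "r - 1"] by auto
  then have "z = x" using entry_row_mono[OF c' z(1)] assms(2) r by simp
  then show False using z(1) changed_entry(2) by (auto simp: in_column_def)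
qed

definition changed where "changed = b[r := (b ! r)[c := x]]"

lemma entry_at_changed:
  "entry_at changed r' c' y \<longleftrightarrow> (if r' = r \<and> c' = c then y = x else entry_at b r' c' y)"
  using changed_entry(1) by (auto simp: changed_def entry_at_def nth_list_update)

text \<open>The row stays sorted by \<open>entry_left_of_changed\<close>. The column stays strict
  because it contained no \<open>x\<close>, so an entry above the changed cell is already smaller
  than \<open>x\<close>.\<close>

lemma changed_in_SSYT: "changed \<in> SSYT n l"
proof -
  have r: "r < length b" "c < length (b ! r)" "b ! r ! c = Suc x"
    using changed_entry(1) by (auto simp: entry_at_def)
  have "map length changed = l"
    using shape r by (intro nth_equalityI) (auto simp: changed_def nth_list_update)
  moreover have "set row \<subseteq> {0..n} \<and> sorted row" if "row \<in> set changed" for row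
  proof -
    have b: "set row \<subseteq> {0..n} \<and> sorted row" if "row \<in> set b" for row
      using that SSYT by (auto simp: SSYT_def)
    have "Suc x \<in> set (b ! r)" using r nth_mem by metis
    then have "Suc x \<le> n" using b[of "b ! r"] r by fastforce
    then have "set ((b ! r)[c := x]) \<subseteq> {0..n}"
      using b[of "b ! r"] r set_update_subset_insert[of "b ! r" c x] by fastforce
    moreover have "sorted ((b ! r)[c := x])"
    proof (rule sorted_iff_nth_mono_less[THEN iffD2], intro allI impI)
      fix j k assume jk: "j < k" "k < length ((b ! r)[c := x])"
      have e: "entry_at b r j (b ! r ! j)" "entry_at b r k (b ! r ! k)"
        using jk r by (auto simp: entry_at_def)
      then have "b ! r ! j \<le> b ! r ! k" using entry_row_mono jk(1) by auto
      then show "(b ! r)[c := x] ! j \<le> (b ! r)[c := x] ! k"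
        using entry_left_of_changed[OF e(1)] jk r by (auto simp: nth_list_update)
    qed
    ultimately have "set row \<subseteq> {0..n} \<and> sorted row" if "row = (b ! r)[c := x]" using that by simp
    then show ?thesis
      using b that set_update_subset_insert[of b r] unfolding changed_def by blast
  qed
  moreover have "changed ! r' ! c' < changed ! Suc r' ! c'"
    if bounds: "Suc r' < length changed" "c' < length (changed ! Suc r')" for r' c'
  proof -
    obtain y' where y': "entry_at changed (Suc r') c' y'" using bounds by (auto simp: entry_at_def)
    obtain z' where z': "entry_at b (Suc r') c' z'" "y' = (if Suc r' = r \<and> c' = c then x else z')"
      using y' changed_entry(1) unfolding entry_at_changed by (auto split: if_splits)
    obtain z where z: "entry_at b r' c' z" "z < z'"
      by (rule entry_above[OF z'(1), of r']) auto
    define y where "y = (if r' = r \<and> c' = c then x else z)"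
    have y: "entry_at changed r' c' y" using z unfolding entry_at_changed y_def by auto
    have "z \<noteq> x" if "c' = c" using changed_entry(2) z(1) that by (auto simp: in_column_def)
    moreover have "z' = Suc x" if "Suc r' = r" "c' = c"
      using entry_unique changed_entry(1) z'(1) that by blast
    moreover have "z = Suc x" if "r' = r" "c' = c"
      using entry_unique changed_entry(1) z(1) that by blast
    ultimately have "y < y'" using z z'(2) unfolding y_def by (auto split: if_splits)
    then show ?thesis using y y' by (simp add: entry_at_def)
  qed
  ultimately show ?thesis by (auto simp: SSYT_def)
qed

text \<open>Only the multiplicities of \<open>Suc x\<close> and \<open>x\<close> in row
  \<open>r\<close> change. For \<open>r = x\<close> the new entry is smaller than the bottom
  \<open>Suc r\<close>, so its segment vanishes, as in the case \<open>h = i\<close> of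
  \<open>e_MS\<close>.\<close>

lemma psi_changed:
  assumes "r \<le> x"
  shows "psi changed = (if r \<noteq> x then psi b - {#(Suc r, Suc x)#} + {#(Suc r, x)#}
    else psi b - {#(Suc x, Suc x)#})"
proof -
  have fin: "finite {c. entry_at b r' c y}" for r' y by (simp add: entry_at_def)
  have entry_c: "entry_at b r c y \<longleftrightarrow> y = Suc x" for y
    using changed_entry(1) by (auto simp: entry_at_def)
  have "{c'. entry_at changed r' c' y} =
    (if r' = r \<and> y = x then insert c {c'. entry_at b r' c' y}
     else if r' = r \<and> y = Suc x then {c'. entry_at b r' c' y} - {c}
     else {c'. entry_at b r' c' y})" for r' y
    using entry_c by (auto simp: entry_at_changed)
  moreover have "\<not> entry_at b r c x" using entry_c by simp
  ultimately have card: "card {c'. entry_at changed r' c' y} =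
    (if r' = r \<and> y = x then Suc (card {c'. entry_at b r' c' y})
     else if r' = r \<and> y = Suc x then card {c'. entry_at b r' c' y} - 1
     else card {c'. entry_at b r' c' y})" for r' y
    using fin changed_entry(1) by (simp add: card_Diff_singleton)
  show ?thesis
  proof (rule multiset_eqI)
    fix s :: segment
    obtain h y where s: "s = (h, y)" by (cases s)
    show "count (psi changed) s = count (if r \<noteq> x then psi b - {#(Suc r, Suc x)#} + {#(Suc r, x)#}
      else psi b - {#(Suc x, Suc x)#}) s"
      using assms by (cases h) (auto simp: s count_psi card)
  qed
qed

end

text \<open>By \<open>first_open_strings\<close> both operators act on the same row. The column of
  the changed cell leaves no trace in \<open>psi\<close>, which forgets the positions within a
  row.\<close>

lemma e_SSYT_crystal:
  "set_option (e_SSYT (Suc x) b) \<subseteq> SSYT n l \<and>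
    map_option psi (e_SSYT (Suc x) b) = e_MS (Suc x) (psi b)"
  using first_open_strings[of x]
proof (cases rule: option.rel_cases)
  case None
  then show ?thesis by (simp add: e_SSYT_def e_MS_def leftmost_open_uncanceled)
next
  case (Some c y)
  then obtain r where r: "r \<le> x" "opens x r \<noteq> []" "c = hd (opens x r)" "y = (Suc r, Suc x)" by blast
  note entry = changed_entry(1)[OF r(2,3)]
  have "(THE r. entry_at b r c (Suc x)) = r"
    using entry entry_unique_row by blast
  then have "e_SSYT (Suc x) b = Some (changed x r c)"
    using Some(1) by (simp add: e_SSYT_def leftmost_open_uncanceled changed_def[OF r(2,3)])
  moreover have "e_MS (Suc x) (psi b) = Some (psi (changed x r c))"
    using Some(2) r(1,4) psi_changed[OF r(2,3,1)] by (simp add: e_MS_def leftmost_open_uncanceled)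
  ultimately show ?thesis using changed_in_SSYT[OF r(2,3)] by simp
qed

end

text \<open>Row \<open>r\<close> has no entries below \<open>r\<close>, so \<open>psi\<close> loses
  only its entries equal to \<open>r\<close>. Their number is recovered from the row length, which
  the shape fixes, and a sorted row is determined by its multiset of entries.\<close>

lemma inj_on_psi:
  assumes "is_partition l"
  shows "inj_on psi (SSYT n l)"
proof (rule inj_onI)
  fix b b' assume b: "b \<in> SSYT n l" and b': "b' \<in> SSYT n l" and eq: "psi b = psi b'"
  interpret b: tableau n l b using assms b by unfold_locales
  interpret b': tableau n l b' using assms b' by unfold_locales
  have len: "length b = length b'" using b.shape b'.shape by (metis length_map)
  show "b = b'"
  proof (rule nth_equalityI[OF len])
    fix r assume r: "r < length b"
    have card: "card {c. entry_at d r c y} = count (mset (d ! r)) y" if "r < length d" for d y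
      using that by (simp add: entry_at_def count_mset_card)
    have counts: "count (mset (b ! r)) y = count (mset (b' ! r)) y" if "y \<noteq> r" for y
    proof (cases "y < r")
      case True
      have "entry_at d r c y \<longrightarrow> r \<le> y" if "d = b \<or> d = b'" for d c
        using that b.row_le_entry b'.row_le_entry by blast
      then have "{c. entry_at b r c y} = {}" "{c. entry_at b' r c y} = {}" using True by force+
      then show ?thesis using card r len by (metis card.empty)
    next
      case False
      then show ?thesis
        using arg_cong[OF eq, of "\<lambda>M. count M (Suc r, y)"] card[of b y] card[of b' y] that r len
        by (simp add: count_psi)
    qed
    have "M = replicate_mset (count M r) r + filter_mset (\<lambda>y. y \<noteq> r) M" for M :: "nat multiset"
      by (intro multiset_eqI) auto
    then have "size M = count M r + size (filter_mset (\<lambda>y. y \<noteq> r) M)" for M :: "nat multiset"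
      by (metis size_replicate_mset size_union)
    moreover have "filter_mset (\<lambda>y. y \<noteq> r) (mset (b ! r)) = filter_mset (\<lambda>y. y \<noteq> r) (mset (b' ! r))"
      using counts by (intro multiset_eqI) auto
    moreover have "size (mset (b ! r)) = size (mset (b' ! r))"
      using b.length_row b'.length_row r len by simp
    ultimately have "count (mset (b ! r)) r = count (mset (b' ! r)) r"
      by (metis add_right_cancel)
    then have "mset (b ! r) = mset (b' ! r)" using counts by (metis multiset_eqI)
    moreover have "sorted (b ! r)" "sorted (b' ! r)"
      using b b' r len by (auto simp: SSYT_def)
    ultimately show "b ! r = b' ! r" using properties_for_sort by metis
  qed
qed

theorem theorem3p11:
  fixes n :: nat and l :: "nat list"
  assumes "n \<ge> 1" and "is_partition l" and "length l \<le> n + 1"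
  shows "psi ` SSYT n l \<subseteq> MS n
    \<and> inj_on psi (SSYT n l)
    \<and> (\<forall>b \<in> SSYT n l. \<forall>i \<in> {1..n}.
         set_option (e_SSYT i b) \<subseteq> SSYT n l
       \<and> map_option psi (e_SSYT i b) = e_MS i (psi b))"
proof (intro conjI ballI)
  fix b i assume "b \<in> SSYT n l" "i \<in> {1..n}"
  then interpret tableau n l b using assms(2) by unfold_locales
  \<comment> \<open>Writing \<open>i\<close> as a successor makes the truncated \<open>i - 1\<close>
    in the definitions exact.\<close>
  obtain x where "i = Suc x" using \<open>i \<in> {1..n}\<close> by (cases i) auto
  then show "set_option (e_SSYT i b) \<subseteq> SSYT n l" "map_option psi (e_SSYT i b) = e_MS i (psi b)"
    using e_SSYT_crystal by auto
qed (use psi_in_MS inj_on_psi assms(2) in auto)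

end
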